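(* Let $m\in\{2,3\}$, let $p^0\in\mathbb R^m$ be the source and let $p_1,p_2,\ldots\in\mathbb R^m$ be sensor positions. Let $\alpha>0$ and $0<\sigma^2<\infty$ be known constants, and let $$y_i=\log_{10}\|p_i-p^0\|+\omega_i,\qquad i=1,2,\dots,$$ where $\omega_1,\omega_2,\ldots$ are i.i.d. Gaussian random variables with mean $0$ and variance $\sigma^2/(100\alpha^2)$. Suppose: (a) The source $p^0$ lies within a bounded set $\mathcal P^0$, and the sensors $p_i$, $i=1,\dots,n$, belong to a bounded set $\mathcal P$, independent of $n$; moreover $\mathcal P^0\cap\mathcal P=\emptyset$. (b) The empirical distribution function of $p_1,\dots,p_n$ converges, as $n\to\infty$, to a distribution function $F_\mu$, and $\mu$ denotes the probability measure induced by $F_\mu$. (c) For every $n\ge m+1$, the sensors $p_1,\dots,p_n$ do not lie on a line (when $m=2$) or on a plane (when $m=3$). Moreover, there does not exist any subset $\mathcal P'$ of $\mathcal P$ with $\mu(\mathcal P')=1$ such that $\mathcal P'$ lies entirely on a line (for $m=2$) or on a plane (for $m=3$). Let $b=\mathbb E(10^{2\omega_i})=e^{(\ln 10)^2\sigma^2/(50\alpha^2)}$, let $X\in\mathbb R^{n\times(m+1)}$ be the matrix with $i$-th row $b\,[-2p_i^T,\ 1]$, let $Y\in\mathbb R^n$ be the vector with $i$-th entry $10^{2y_i}-b\|p_i\|^2$, let $\widehat\theta_n=(X^TX)^{-1}X^TY$, and let $\widehat p_n=[\widehat\theta_n]_{1:m}$ be the vector of the first $m$ entries of $\widehat\theta_n$.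 Then $$\widehat p_n-p^0=O_p(1/\sqrt n).$$
   Context: $\|\cdot\|$ is the Euclidean norm. The empirical distribution of $p_1,\dots,p_n$ is $\frac1n\sum_{i=1}^n\delta_{p_i}$, with $\delta_x$ the Dirac measure at $x$; convergence of distribution functions is in the usual sense (weak convergence). $X_n=O_p(c_n)$ means that $X_n/c_n$ is bounded in probability. Under the stated assumptions $X^TX$ is invertible for $n\ge m+1$. The model arises from received-signal-strength measurements $10\log_{10}(P_i)=10\log_{10}(P_0)-10\alpha\log_{10}\|p_i-p^0\|+\varepsilon_i$ with known constants $P_0>0$ and $\alpha$ and i.i.d. Gaussian noises $\varepsilon_i$ of mean $0$ and variance $\sigma^2$, by setting $y_i=-(\log_{10}P_i-\log_{10}P_0)/\alpha$ and $\omega_i=-\varepsilon_i/(10\alpha)$.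
   Formalization: In (c), the sets P' with μ(P')=1 that must not lie on a line or plane range over subsets of the closure of P instead of P; for P not closed μ may give P mass 0, so the literal condition can hold vacuously and the claim then fails. *)

theory Defs
  imports "HOL-Probability.Probability"
begin

subsection \<open>Distribution functions on \<open>\<real>\<^sup>m\<close> and their convergence\<close>

text \<open>The order on \<^typ>\<open>real^'m\<close> is componentwise, so \<open>{..x}\<close> is the closed lower orthant at \<open>x\<close>.
  The library's \<^const>\<open>cdf\<close> and \<^const>\<open>weak_conv\<close> are the special case of the real line.\<close>

definition dist_fun :: "(real^'m) measure \<Rightarrow> real^'m \<Rightarrow> real" where
  "dist_fun \<nu> x = measure \<nu> {..x}"

definition dist_fun_conv :: "(nat \<Rightarrow> real^'m \<Rightarrow> real) \<Rightarrow> (real^'m \<Rightarrow> real) \<Rightarrow> bool" where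
  "dist_fun_conv Fs F \<longleftrightarrow> (\<forall>x. isCont F x \<longrightarrow> (\<lambda>n. Fs n x) \<longlonglongrightarrow> F x)"

text \<open>\<open>(1/n) (\<delta>\<^bsub>p 1\<^esub> + \<dots> + \<delta>\<^bsub>p n\<^esub>)\<close>, as the image of the uniform distribution on the indices.\<close>

definition empirical_distr :: "nat \<Rightarrow> (nat \<Rightarrow> real^'m) \<Rightarrow> (real^'m) measure" where
  "empirical_distr n p = distr (uniform_count_measure {1..n}) borel p"

lemma measure_empirical_distr:
  assumes "n > 0" "A \<in> sets borel"
  shows "measure (empirical_distr n p) A = real (card {i\<in>{1..n}. p i \<in> A}) / real n"
proof -
  have "measure (empirical_distr n p) A
      = measure (uniform_count_measure {1..n}) (p -` A \<inter> {1..n})"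
    unfolding empirical_distr_def using assms(2)
    by (subst measure_distr)
       (auto simp: measurable_def space_uniform_count_measure sets_uniform_count_measure)
  also have "\<dots> = real (card (p -` A \<inter> {1..n})) / real n"
    by (subst measure_uniform_count_measure) auto
  also have "p -` A \<inter> {1..n} = {i\<in>{1..n}. p i \<in> A}"
    by auto
  finally show ?thesis .
qed


subsection \<open>Lines and planes\<close>

text \<open>Affine subspaces of codimension one: lines in the plane, planes in three-space.\<close>

definition on_hyperplane :: "(real^'m) set \<Rightarrow> bool" where
  "on_hyperplane S \<longleftrightarrow> (\<exists>H. affine H \<and> aff_dim H = int CARD('m) - 1 \<and> S \<subseteq> H)"

text \<open>The measure \<open>\<mu>\<close> arises as a weak limit of measures carried by \<open>P\<close>, hence it is carried by the
  closure of \<open>P\<close>, but it may vanish on \<open>P\<close> itself if \<open>P\<close> is not closed. The subsets are therefore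
  taken from \<open>closure P\<close>: for \<open>P\<close> closed, and more generally for \<open>\<mu>(P) = 1\<close>, this
  is the same as taking them from \<open>P\<close>, and otherwise it prevents the negated condition from
  holding vacuously.\<close>

definition full_mass_on_hyperplane :: "(real^'m) measure \<Rightarrow> (real^'m) set \<Rightarrow> bool" where
  "full_mass_on_hyperplane \<mu> P \<longleftrightarrow>
     (\<exists>P'\<subseteq>closure P. P' \<in> sets borel \<and> measure \<mu> P' = 1 \<and> on_hyperplane P')"


subsection \<open>Boundedness in probability\<close>

definition bounded_in_prob ::
    "'a measure \<Rightarrow> (nat \<Rightarrow> 'a \<Rightarrow> 'b::real_normed_vector) \<Rightarrow> bool" where
  "bounded_in_prob M X \<longleftrightarrow>
     (\<forall>n. X n \<in> borel_measurable M) \<and>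
     (\<forall>\<epsilon>>0. \<exists>K. \<forall>\<^sub>F n in sequentially. measure M {x\<in>space M. norm (X n x) > K} \<le> \<epsilon>)"

definition bigO_prob ::
    "'a measure \<Rightarrow> (nat \<Rightarrow> 'a \<Rightarrow> 'b::real_normed_vector) \<Rightarrow> (nat \<Rightarrow> real) \<Rightarrow> bool" where
  "bigO_prob M X c \<longleftrightarrow> bounded_in_prob M (\<lambda>n x. X n x /\<^sub>R c n)"


subsection \<open>Ordinary least squares\<close>

text \<open>The number of rows varies while the number of columns is fixed. An \<open>n \<times> k\<close> matrix is given by
  its rows \<open>X 1, \<dots>, X n\<close> and a vector with \<open>n\<close> entries by \<open>Y 1, \<dots>, Y n\<close>; the first two
  definitions are the products \<open>X\<^sup>TX\<close> and \<open>X\<^sup>TY\<close>.\<close>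

definition gram_matrix :: "nat \<Rightarrow> (nat \<Rightarrow> real^'k) \<Rightarrow> real^'k^'k" where
  "gram_matrix n X = (\<chi> j k. \<Sum>i=1..n. X i $ j * X i $ k)"

definition transpose_mult_vec :: "nat \<Rightarrow> (nat \<Rightarrow> real^'k) \<Rightarrow> (nat \<Rightarrow> real) \<Rightarrow> real^'k" where
  "transpose_mult_vec n X Y = (\<chi> j. \<Sum>i=1..n. X i $ j * Y i)"

definition least_squares :: "nat \<Rightarrow> (nat \<Rightarrow> real^'k) \<Rightarrow> (nat \<Rightarrow> real) \<Rightarrow> real^'k" where
  "least_squares n X Y = matrix_inv (gram_matrix n X) *v transpose_mult_vec n X Y"


subsection \<open>The location estimator\<close>

text \<open>The \<open>m + 1\<close> columns are indexed by \<^typ>\<open>'m option\<close>: \<^term>\<open>Some k\<close> stands for the \<open>k\<close>-th of the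
  first \<open>m\<close> columns, \<^term>\<open>None\<close> for the last one.\<close>

definition design_row :: "real \<Rightarrow> (nat \<Rightarrow> real^'m) \<Rightarrow> nat \<Rightarrow> real^('m option)" where
  "design_row b p i = b *\<^sub>R (\<chi> j. case j of Some k \<Rightarrow> - 2 * p i $ k | None \<Rightarrow> 1)"

definition response :: "real \<Rightarrow> (nat \<Rightarrow> real^'m) \<Rightarrow> (nat \<Rightarrow> real) \<Rightarrow> nat \<Rightarrow> real" where
  "response b p y i = 10 powr (2 * y i) - b * (norm (p i))\<^sup>2"

definition theta_hat :: "real \<Rightarrow> (nat \<Rightarrow> real^'m) \<Rightarrow> (nat \<Rightarrow> real) \<Rightarrow> nat \<Rightarrow> real^('m option)" where
  "theta_hat b p y n = least_squares n (design_row b p) (response b p y)"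

definition p_hat :: "real \<Rightarrow> (nat \<Rightarrow> real^'m) \<Rightarrow> (nat \<Rightarrow> real) \<Rightarrow> nat \<Rightarrow> real^'m" where
  "p_hat b p y n = (\<chi> k. theta_hat b p y n $ Some k)"

lemma (in prob_space) expectation_10_powr_normal:
  fixes \<sigma> \<alpha> :: real
  assumes "\<sigma> > 0" "\<alpha> > 0"
    and D: "distributed M lborel W (normal_density 0 (\<sigma> / (10 * \<alpha>)))"
  shows "expectation (\<lambda>x. 10 powr (2 * W x)) = exp ((ln 10)\<^sup>2 * \<sigma>\<^sup>2 / (50 * \<alpha>\<^sup>2))"
proof -
  define s where "s = \<sigma> / (10 * \<alpha>)"
  define t :: real where "t = 2 * ln 10"
  have s: "s > 0" using assms by (simp add: s_def)
  have shift: "normal_density 0 s u * 10 powr (2 * u)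
      = exp (s\<^sup>2 * t\<^sup>2 / 2) * normal_density (s\<^sup>2 * t) s u" for u
  proof -
    have "- u\<^sup>2 / (2 * s\<^sup>2) + t * u = s\<^sup>2 * t\<^sup>2 / 2 + - (u - s\<^sup>2 * t)\<^sup>2 / (2 * s\<^sup>2)"
      using s by (simp add: field_simps power2_eq_square)
    then have "exp (- u\<^sup>2 / (2 * s\<^sup>2)) * exp (t * u)
        = exp (s\<^sup>2 * t\<^sup>2 / 2) * exp (- (u - s\<^sup>2 * t)\<^sup>2 / (2 * s\<^sup>2))"
      by (metis exp_add)
    then show ?thesis
      by (simp add: normal_density_def powr_def t_def mult_ac)
  qed
  have "expectation (\<lambda>x. 10 powr (2 * W x))
      = (\<integral>u. normal_density 0 s u * 10 powr (2 * u) \<partial>lborel)"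
    using distributed_integral[OF D, of "\<lambda>u. 10 powr (2 * u)"] by (simp add: s_def)
  also have "\<dots> = exp (s\<^sup>2 * t\<^sup>2 / 2)"
    using s by (simp add: shift)
  also have "s\<^sup>2 * t\<^sup>2 / 2 = (ln 10)\<^sup>2 * \<sigma>\<^sup>2 / (50 * \<alpha>\<^sup>2)"
    using assms by (simp add: s_def t_def field_simps power2_eq_square)
  finally show ?thesis .
qed

end

theory Submission
  imports Defs
begin

text \<open>
  The response satisfies \<open>Y\<^sub>i = X\<^sub>i \<bullet> \<theta>\<^sub>0 + e\<^sub>i\<close> with \<open>\<theta>\<^sub>0 = (p\<^sup>0, \<parallel>p\<^sup>0\<parallel>\<^sup>2)\<close> and independent centred
  errors \<open>e\<^sub>i = \<parallel>p\<^sub>i - p\<^sup>0\<parallel>\<^sup>2 (10 powr (2 \<omega>\<^sub>i) - b)\<close> of uniformly bounded variance. Hence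
  \<open>X\<^sup>TX (\<theta>\<^sub>n - \<theta>\<^sub>0) = \<Sum>\<^sub>i e\<^sub>i X\<^sub>i\<close> for the estimator \<open>\<theta>\<^sub>n\<close>, and by Chebyshev's inequality the right-hand
  side is of order \<open>\<surd>n\<close> in probability.

  It remains to see that the least eigenvalue of \<open>X\<^sup>TX\<close> is eventually at least \<open>c n\<close> for some \<open>c > 0\<close>.
  Otherwise, by compactness of the unit sphere, there is a unit vector \<open>l\<close> such that along a
  subsequence the fraction of sensors near any point off the set \<open>H = {x. g x \<bullet> l = 0}\<close>, with \<open>g x\<close>
  the row of a sensor at \<open>x\<close>, tends to zero. As the empirical distribution functions converge, all of
  the mass of \<open>\<mu>\<close> lies on \<open>H\<close>, which is a hyperplane or empty.
\<close>

subsection \<open>Convergence of distribution functions on boxes\<close>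

text \<open>Dominated convergence: off the coordinate hyperplanes through \<open>x\<close>, which
  are null, every coordinate inequality between \<open>y\<close> and \<open>x\<close> is strict or
  fails strictly, so it is eventually the same for \<open>X n\<close> in place of
  \<open>x\<close>.\<close>

lemma isCont_dist_fun:
  fixes \<nu> :: "(real^'m) measure"
  assumes fin: "finite_measure \<nu>" and sets: "sets \<nu> = sets borel"
    and null: "\<And>k. measure \<nu> {y. y $ k = x $ k} = 0"
  shows "isCont (dist_fun \<nu>) x"
  unfolding continuous_at_sequentially
proof (intro allI impI)
  interpret finite_measure \<nu> by (fact fin)
  have space: "space \<nu> = UNIV"
    using sets_eq_imp_space_eq[OF sets] by simp
  fix X :: "nat \<Rightarrow> real^'m" assume X: "X \<longlonglongrightarrow> x"
  have eq: "dist_fun \<nu> z = integral\<^sup>L \<nu> (indicator {..z})" for z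
    by (simp add: dist_fun_def sets space)
  have ae: "AE y in \<nu>. y $ k \<noteq> x $ k" for k
  proof (rule AE_I[where N = "{y. y $ k = x $ k}"])
    show "emeasure \<nu> {y. y $ k = x $ k} = 0"
      using null by (simp add: emeasure_eq_measure)
    show "{y. y $ k = x $ k} \<in> sets \<nu>"
      unfolding sets by measurable
  qed auto
  have lim: "AE y in \<nu>. (\<lambda>n. indicator {..X n} y) \<longlonglongrightarrow> (indicator {..x} y :: real)"
  proof -
    have "AE y in \<nu>. \<forall>k\<in>UNIV. y $ k \<noteq> x $ k"
      by (rule AE_finite_allI) (use ae in auto)
    then show ?thesis
    proof eventually_elim
      case (elim y)
      have "eventually (\<lambda>n. y $ k \<le> X n $ k \<longleftrightarrow> y $ k \<le> x $ k) sequentially" for k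
      proof (cases "y $ k < x $ k")
        case True
        then show ?thesis
          using order_tendstoD(1)[OF tendsto_vec_nth[OF X] True] by (auto elim!: eventually_mono)
      next
        case False
        then have lt: "x $ k < y $ k" using elim by (metis UNIV_I linorder_neqE)
        show ?thesis
          using order_tendstoD(2)[OF tendsto_vec_nth[OF X] lt] lt by (auto elim!: eventually_mono)
      qed
      then have "eventually (\<lambda>n. \<forall>k. y $ k \<le> X n $ k \<longleftrightarrow> y $ k \<le> x $ k) sequentially"
        by (rule eventually_all_finite)
      then have "eventually (\<lambda>n. indicator {..X n} y = (indicator {..x} y :: real)) sequentially"
        by eventually_elim (simp add: indicator_def less_eq_vec_def)
      then show ?case by (rule tendsto_eventually)
    qed
  qed
  show "(dist_fun \<nu> \<circ> X) \<longlonglongrightarrow> dist_fun \<nu> x"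
    unfolding comp_def eq
    by (rule integral_dominated_convergence[where w = "\<lambda>_. 1"])
       (use lim in \<open>auto simp: sets indicator_def cong: measurable_cong_sets\<close>)
qed

text \<open>These values are the atoms of a finite measure on the line, the image under the
  \<open>k\<close>-th coordinate. Boxes with null faces can therefore be found at every
  scale.\<close>

lemma countable_charged_coordinate_values:
  fixes \<nu> :: "(real^'m) measure"
  assumes fin: "finite_measure \<nu>" and sets: "sets \<nu> = sets borel"
  shows "countable {c. measure \<nu> {y. y $ k = c} \<noteq> 0}"
proof -
  interpret finite_measure \<nu> by (fact fin)
  have space: "space \<nu> = UNIV"
    using sets_eq_imp_space_eq[OF sets] by simp
  have meas: "(\<lambda>y. y $ k) \<in> borel_measurable \<nu>"
    unfolding measurable_cong_sets[OF sets refl] by measurable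
  interpret D: finite_measure "distr \<nu> borel (\<lambda>y. y $ k)"
    by (rule finite_measure_distr[OF meas])
  have "measure (distr \<nu> borel (\<lambda>y. y $ k)) {c} = measure \<nu> {y. y $ k = c}" for c
    by (subst measure_distr[OF meas]) (auto simp: space vimage_def)
  then show ?thesis
    using D.countable_support by simp
qed

text \<open>Lower bounds are imposed one coordinate at a time, starting from the closed orthant at
  \<open>b\<close>; differences of closed orthants are what makes the box half-open. Every corner
  that arises takes its coordinates from \<open>a\<close> and \<open>b\<close>, so it is a
  continuity point of the limit.\<close>

lemma dist_fun_conv_halfopen_box:
  fixes \<nu> :: "nat \<Rightarrow> (real^'m) measure" and \<mu> :: "(real^'m) measure"
  assumes conv: "dist_fun_conv (\<lambda>n. dist_fun (\<nu> n)) (dist_fun \<mu>)"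
    and fin: "\<And>n. finite_measure (\<nu> n)" "finite_measure \<mu>"
    and sets: "\<And>n. sets (\<nu> n) = sets borel" "sets \<mu> = sets borel"
    and null: "\<And>k. measure \<mu> {y. y $ k = a $ k} = 0" "\<And>k. measure \<mu> {y. y $ k = b $ k} = 0"
    and le: "a \<le> b"
  shows "(\<lambda>n. measure (\<nu> n) {y. y \<le> b \<and> (\<forall>k. a $ k < y $ k)})
           \<longlonglongrightarrow> measure \<mu> {y. y \<le> b \<and> (\<forall>k. a $ k < y $ k)}"
proof -
  let ?A = "\<lambda>S c. {y. y \<le> c \<and> (\<forall>k\<in>S. a $ k < y $ k)}"
  have A_borel: "?A S c \<in> sets borel" for S :: "'m set" and c :: "real^'m"
    unfolding less_eq_vec_def by measurable
  \<comment> \<open>The corner \<open>c\<close> must vary in the induction over the constrained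
    coordinates \<open>S\<close>, since the induction step moves it.\<close>
  have "(\<lambda>n. measure (\<nu> n) (?A S c)) \<longlonglongrightarrow> measure \<mu> (?A S c)"
    if "finite S" "\<And>k. measure \<mu> {y. y $ k = c $ k} = 0" "a \<le> c" for S c
    using that
  proof (induction S arbitrary: c rule: finite_induct)
    case empty
    have "isCont (dist_fun \<mu>) c"
      using fin(2) sets(2) empty(1) by (rule isCont_dist_fun)
    then show ?case
      using conv by (simp add: dist_fun_conv_def dist_fun_def atMost_def)
  next
    case (insert k S)
    \<comment> \<open>Adding the constraint \<open>a $ k < y $ k\<close> removes the same box with upper corner moved to \<open>a $ k\<close> in
      direction \<open>k\<close>.\<close>
    let ?c = "\<chi> j. if j = k then a $ k else c $ j"
    have sub: "?A S ?c \<subseteq> ?A S c"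
    proof
      fix y assume y: "y \<in> ?A S ?c"
      have "y $ j \<le> c $ j" for j
      proof -
        have "y $ j \<le> ?c $ j" using y by (simp only: mem_Collect_eq less_eq_vec_def)
        also have "\<dots> \<le> c $ j" using insert.prems(2) by (simp add: less_eq_vec_def)
        finally show ?thesis .
      qed
      then show "y \<in> ?A S c" using y by (simp add: less_eq_vec_def)
    qed
    have diff: "?A (insert k S) c = ?A S c - ?A S ?c"
    proof (rule set_eqI)
      fix y
      show "y \<in> ?A (insert k S) c \<longleftrightarrow> y \<in> ?A S c - ?A S ?c"
      proof (cases "y \<in> ?A S c")
        case True
        then have "y \<le> ?c \<longleftrightarrow> y $ k \<le> a $ k"
          by (auto simp: less_eq_vec_def)
        then show ?thesis using True by auto
      next
        case False
        then show ?thesis by auto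
      qed
    qed
    have "measure (\<nu> n) (?A (insert k S) c) = measure (\<nu> n) (?A S c) - measure (\<nu> n) (?A S ?c)" for n
    proof -
      interpret finite_measure "\<nu> n" by (fact fin)
      show ?thesis unfolding diff by (rule finite_measure_Diff) (simp_all add: sets A_borel sub)
    qed
    moreover have "measure \<mu> (?A (insert k S) c) = measure \<mu> (?A S c) - measure \<mu> (?A S ?c)"
    proof -
      interpret finite_measure \<mu> by (fact fin)
      show ?thesis unfolding diff by (rule finite_measure_Diff) (simp_all add: sets A_borel sub)
    qed
    moreover have "(\<lambda>n. measure (\<nu> n) (?A S c)) \<longlonglongrightarrow> measure \<mu> (?A S c)"
      using insert by blast
    moreover have "(\<lambda>n. measure (\<nu> n) (?A S ?c)) \<longlonglongrightarrow> measure \<mu> (?A S ?c)"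
      by (rule insert.IH) (use insert.prems null in \<open>auto simp: less_eq_vec_def\<close>)
    ultimately show ?case
      by (simp add: tendsto_diff)
  qed
  from this[of UNIV b] show ?thesis
    using null le by simp
qed

text \<open>Each point of \<open>U\<close> lies in a small box with uncharged faces; its \<mu>-mass
  is the limit of the masses along \<open>r\<close>, hence zero. Countably many such boxes cover
  \<open>U\<close>. As \<open>U\<close> is an arbitrary set, it is only placed inside a null
  set.\<close>

lemma dist_fun_conv_null_open:
  fixes \<nu> :: "nat \<Rightarrow> (real^'m) measure" and \<mu> :: "(real^'m) measure"
  assumes conv: "dist_fun_conv (\<lambda>n. dist_fun (\<nu> n)) (dist_fun \<mu>)"
    and fin: "\<And>n. finite_measure (\<nu> n)" "finite_measure \<mu>"
    and sets: "\<And>n. sets (\<nu> n) = sets borel" "sets \<mu> = sets borel"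
    and r: "filterlim r at_top sequentially"
    and small: "\<And>x. x \<in> U \<Longrightarrow> \<exists>e>0. (\<lambda>n. measure (\<nu> (r n)) (ball x e)) \<longlonglongrightarrow> 0"
  shows "\<exists>N\<in>null_sets \<mu>. U \<subseteq> N"
proof -
  define bad where "bad k = {c. measure \<mu> {y. y $ k = c} \<noteq> 0}" for k
  have bad: "countable (bad k)" for k
    unfolding bad_def by (rule countable_charged_coordinate_values[OF fin(2) sets(2)])
  have "\<exists>V. open V \<and> x \<in> V \<and> V \<in> null_sets \<mu>" if x: "x \<in> U" for x
  proof -
    obtain e where e: "e > 0" and lim0: "(\<lambda>n. measure (\<nu> (r n)) (ball x e)) \<longlonglongrightarrow> 0"
      using small[OF x] by blast
    \<comment> \<open>If each coordinate deviates by at most \<open>d\<close>, the l1-norm is at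
      most \<open>e / 2\<close>, which keeps the box inside the ball.\<close>
    define d where "d = e / (2 * real CARD('m))"
    have d: "d > 0" using e by (simp add: d_def)
    have "\<exists>c\<in>{x $ k - d<..<x $ k}. c \<notin> bad k" for k
      by (rule open_minus_countable) (use bad d in auto)
    then obtain a' where a': "\<And>k. a' k \<in> {x $ k - d<..<x $ k}" "\<And>k. a' k \<notin> bad k"
      by metis
    have "\<exists>c\<in>{x $ k<..<x $ k + d}. c \<notin> bad k" for k
      by (rule open_minus_countable) (use bad d in auto)
    then obtain b' where b': "\<And>k. b' k \<in> {x $ k<..<x $ k + d}" "\<And>k. b' k \<notin> bad k"
      by metis
    define a b where "a = vec_lambda a'" and "b = vec_lambda b'"
    let ?B = "{y. y \<le> b \<and> (\<forall>k. a $ k < y $ k)}"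
    have B_borel: "?B \<in> sets borel"
      unfolding less_eq_vec_def by measurable
    have ab: "x $ k - d < a $ k" "a $ k < x $ k" "x $ k < b $ k" "b $ k < x $ k + d" for k
      using a'(1)[of k] b'(1)[of k] by (auto simp: a_def b_def)
    have "(\<lambda>n. measure (\<nu> n) ?B) \<longlonglongrightarrow> measure \<mu> ?B"
    proof (rule dist_fun_conv_halfopen_box[OF conv fin sets])
      show "a \<le> b" using ab by (auto simp: less_eq_vec_def) (meson less_imp_le less_trans)
    qed (use a'(2) b'(2) in \<open>auto simp: a_def b_def bad_def\<close>)
    then have lim: "(\<lambda>n. measure (\<nu> (r n)) ?B) \<longlonglongrightarrow> measure \<mu> ?B"
      using r by (rule filterlim_compose)
    have "?B \<subseteq> ball x e"
    proof
      fix y assume y: "y \<in> ?B"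
      have "\<bar>(x - y) $ k\<bar> \<le> d" for k
        using y ab[of k] by (auto simp: less_eq_vec_def abs_le_iff)
         (smt (verit))+
      then have "norm (x - y) \<le> (\<Sum>k\<in>(UNIV::'m set). d)"
        by (intro order_trans[OF norm_le_l1_cart] sum_mono)
      also have "\<dots> = e / 2" by (simp add: d_def)
      finally show "y \<in> ball x e" using e by (simp add: dist_norm)
    qed
    then have "measure (\<nu> n) ?B \<le> measure (\<nu> n) (ball x e)" for n
      by (intro finite_measure.finite_measure_mono[OF fin(1)]) (auto simp: sets)
    then have "measure \<mu> ?B \<le> 0"
      by (intro LIMSEQ_le[OF lim lim0]) auto
    then have "measure \<mu> ?B = 0"
      by (simp add: measure_le_0_iff)
    then have B_null: "?B \<in> null_sets \<mu>"
      using B_borel sets finite_measure.emeasure_eq_measure[OF fin(2)] by (auto simp: null_sets_def)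
    \<comment> \<open>The Lindelof argument below needs open neighbourhoods, so the half-open box is
      replaced by its interior.\<close>
    have "box a b \<subseteq> ?B"
      by (auto simp: mem_box_cart less_eq_vec_def less_imp_le)
    then have "box a b \<in> null_sets \<mu>"
      using B_null sets by (auto intro: null_sets_subset)
    moreover have "x \<in> box a b"
      using ab by (auto simp: mem_box_cart)
    ultimately show ?thesis
      using open_box by blast
  qed
  then have "\<exists>V. \<forall>x\<in>U. open (V x) \<and> x \<in> V x \<and> V x \<in> null_sets \<mu>"
    by (intro bchoice) blast
  then obtain V where V: "\<And>x. x \<in> U \<Longrightarrow> open (V x) \<and> x \<in> V x \<and> V x \<in> null_sets \<mu>"
    by blast
  obtain F where F: "F \<subseteq> V ` U" "countable F" "\<Union> F = \<Union> (V ` U)"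
    by (rule Lindelof[of "V ` U"]) (use V in blast)+
  have "\<Union> F \<in> null_sets \<mu>"
  proof -
    have "(\<Union>W\<in>F. W) \<in> null_sets \<mu>"
      using F(2) by (rule null_sets_UN') (use F(1) V in blast)
    then show ?thesis by simp
  qed
  moreover have "U \<subseteq> \<Union> F"
    unfolding F(3) using V by auto
  ultimately show ?thesis by blast
qed

subsection \<open>Lower bound for the Gram matrix\<close>

lemma finite_measure_empirical_distr: "finite_measure (empirical_distr n (p :: nat \<Rightarrow> real^'m))"
proof -
  have "finite_measure (uniform_count_measure {1..n})"
  proof (cases "n = 0")
    \<comment> \<open>Without indices the space is empty, so the measure is finite though not a
      probability measure.\<close>
    case True
    then show ?thesis by (intro finite_measureI) (simp add: space_uniform_count_measure)
  next
    case False
    then show ?thesis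
      by (intro prob_space.finite_measure prob_space_uniform_count_measure) auto
  qed
  moreover have "p \<in> measurable (uniform_count_measure {1..n}) borel"
    by (simp add: measurable_def space_uniform_count_measure sets_uniform_count_measure)
  ultimately show ?thesis
    unfolding empirical_distr_def by (rule finite_measure.finite_measure_distr)
qed

lemma sum_UNIV_option:
  fixes f :: "'k::finite option \<Rightarrow> 'c::comm_monoid_add"
  shows "(\<Sum>j\<in>UNIV. f j) = f None + (\<Sum>k\<in>UNIV. f (Some k))"
  by (simp add: UNIV_option_conv sum.reindex)

text \<open>For fixed \<open>\<theta>\<close> the product is affine in the position of the sensor.
  For \<open>b \<noteq> 0\<close> its zero set is a hyperplane unless the spatial part of
  \<open>\<theta>\<close> vanishes.\<close>

lemma inner_design_row:
  "design_row b p i \<bullet> \<theta> = b * (\<theta> $ None - 2 * ((\<chi> k. \<theta> $ Some k) \<bullet> p i))"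
  by (simp add: design_row_def inner_vec_def sum_UNIV_option sum_distrib_left sum_negf algebra_simps)

lemma norm_design_row_le:
  fixes p :: "nat \<Rightarrow> real^'m"
  shows "norm (design_row b p i) \<le> \<bar>b\<bar> * (1 + 2 * norm (p i))"
proof -
  let ?v = "(\<chi> j. case j of Some k \<Rightarrow> - 2 * p i $ k | None \<Rightarrow> 1) :: real^'m option"
  have "(norm ?v)\<^sup>2 = 1 + 4 * (norm (p i))\<^sup>2"
    unfolding power2_norm_eq_inner inner_vec_def
    by (simp add: sum_UNIV_option sum_distrib_left)
  also have "\<dots> \<le> (1 + 2 * norm (p i))\<^sup>2"
    by (simp add: power2_eq_square algebra_simps)
  finally have "norm ?v \<le> 1 + 2 * norm (p i)"
    by (rule power2_le_imp_le) simp
  then have "\<bar>b\<bar> * norm ?v \<le> \<bar>b\<bar> * (1 + 2 * norm (p i))"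
    by (rule mult_left_mono) simp
  then show ?thesis
    unfolding design_row_def norm_scaleR .
qed

text \<open>The sum is the quadratic form of the Gram matrix at \<open>\<theta>\<close>, so
  \<open>c * real n\<close> bounds the least eigenvalue from below. The constant comes from
  compactness and is not explicit.\<close>

lemma gram_lower_bound:
  fixes p :: "nat \<Rightarrow> real^'m" and \<mu> :: "(real^'m) measure"
  assumes p: "\<And>i. i \<ge> 1 \<Longrightarrow> p i \<in> P"
    and \<mu>: "prob_space \<mu>" "sets \<mu> = sets borel"
    and conv: "dist_fun_conv (\<lambda>n. dist_fun (empirical_distr n p)) (dist_fun \<mu>)"
    and nondeg: "\<not> full_mass_on_hyperplane \<mu> P"
    and b: "b \<noteq> 0"
  shows "\<exists>c>0. \<forall>\<^sub>F n in sequentially.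
           \<forall>\<theta>. c * real n * (norm \<theta>)\<^sup>2 \<le> (\<Sum>i=1..n. (design_row b p i \<bullet> \<theta>)\<^sup>2)"
proof (rule ccontr)
  \<comment> \<open>The row as a function of the position, so that it can be evaluated at points
    that are not sensors; the index \<open>0\<close> is a dummy.\<close>
  define g where "g x = design_row b (\<lambda>_. x) 0" for x :: "real^'m"
  have row: "design_row b p i = g (p i)" for i
    by (simp add: g_def design_row_def)
  have g_inner: "g x \<bullet> \<theta> = b * (\<theta> $ None - 2 * ((\<chi> k. \<theta> $ Some k) \<bullet> x))" for x \<theta>
    by (simp add: g_def inner_design_row)
  assume contra: "\<not> ?thesis"
  \<comment> \<open>The failure of the bound for the constant \<open>1 / Suc k\<close>, with the
    direction normalised by homogeneity. The condition \<open>n \<ge> Suc k\<close> makes the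
    indices diverge.\<close>
  have "\<exists>n \<theta>. n \<ge> Suc k \<and> norm \<theta> = 1 \<and> (\<Sum>i=1..n. (g (p i) \<bullet> \<theta>)\<^sup>2) \<le> real n / real (Suc k)" for k
  proof -
    define c where "c = 1 / real (Suc k)"
    have "c > 0" by (simp add: c_def)
    then have "\<not> (\<forall>\<^sub>F n in sequentially. \<forall>\<theta>. c * real n * (norm \<theta>)\<^sup>2
               \<le> (\<Sum>i=1..n. (g (p i) \<bullet> \<theta>)\<^sup>2))"
      using contra unfolding row by blast
    then have "\<exists>n\<ge>Suc k. \<exists>\<theta>. (\<Sum>i=1..n. (g (p i) \<bullet> \<theta>)\<^sup>2) < c * real n * (norm \<theta>)\<^sup>2"
      unfolding eventually_sequentially by (meson not_le)
    then obtain n \<theta> where n: "n \<ge> Suc k"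
      and lt: "(\<Sum>i=1..n. (g (p i) \<bullet> \<theta>)\<^sup>2) < c * real n * (norm \<theta>)\<^sup>2"
      by blast
    have "\<theta> \<noteq> 0"
      using lt by auto
    then have nz: "norm \<theta> > 0" by simp
    have "(\<Sum>i=1..n. (g (p i) \<bullet> (\<theta> /\<^sub>R norm \<theta>))\<^sup>2) = (\<Sum>i=1..n. (g (p i) \<bullet> \<theta>)\<^sup>2) / (norm \<theta>)\<^sup>2"
      by (simp add: sum_divide_distrib field_simps)
    also have "\<dots> \<le> real n / real (Suc k)"
      using lt nz by (simp add: c_def field_simps)
    finally show ?thesis
      using n nz by (intro exI[of _ n] exI[of _ "\<theta> /\<^sub>R norm \<theta>"]) simp
  qed
  then obtain N t where N: "\<And>k. N k \<ge> Suc k" and t: "\<And>k. norm (t k) = 1"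
    and small: "\<And>k. (\<Sum>i=1..N k. (g (p i) \<bullet> t k)\<^sup>2) \<le> real (N k) / real (Suc k)"
    by metis
  have "compact (sphere 0 1 :: (real^'m option) set)"
    by simp
  moreover have "\<forall>k. t k \<in> sphere 0 1"
    using t by simp
  ultimately obtain l s where l: "l \<in> sphere 0 1" and s: "strict_mono s"
    and lim: "(t \<circ> s) \<longlonglongrightarrow> l"
    unfolding compact_def by metis
  have Ns: "filterlim (\<lambda>k. N (s k)) at_top sequentially"
  proof (rule filterlim_at_top_mono[OF filterlim_ident])
    show "\<forall>\<^sub>F k in sequentially. k \<le> N (s k)"
      using N seq_suble[OF s] by (intro always_eventually allI) (meson Suc_leD order_trans)
  qed
  define H where "H = {x. g x \<bullet> l = 0}"
  have H_closed: "closed H"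
    unfolding H_def g_inner by (intro closed_Collect_eq continuous_intros)
  \<comment> \<open>Near a point off the closure of \<open>P\<close> there are no sensors at all;
    near a point of the closure off \<open>H\<close> the small quadratic form leaves room for few of
    them.\<close>
  have "\<exists>e>0. (\<lambda>k. measure (empirical_distr (N (s k)) p) (ball x e)) \<longlonglongrightarrow> 0"
    if x: "x \<in> - (H \<inter> closure P)" for x
  proof (cases "x \<in> closure P")
    case False
    then have "open (- closure P)" "x \<in> - closure P" by auto
    then obtain e where e: "e > 0" "ball x e \<subseteq> - closure P"
      using open_contains_ball by blast
    have "measure (empirical_distr (N (s k)) p) (ball x e) = 0" for k
    proof -
      have "{i\<in>{1..N (s k)}. p i \<in> ball x e} = {}"
        using e(2) p closure_subset[of P] by fastforce
      then show ?thesis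
        using N[of "s k"] by (subst measure_empirical_distr) auto
    qed
    then show ?thesis using e(1) by auto
  next
    case True
    then have nz: "g x \<bullet> l \<noteq> 0" using x by (auto simp: H_def)
    \<comment> \<open>Half of the value at \<open>(x, l)\<close> stays a strict lower bound on a
      neighbourhood in both variables. The second variable is needed because \<open>t (s k)\<close>
      only tends to \<open>l\<close>.\<close>
    define \<delta> where "\<delta> = \<bar>g x \<bullet> l\<bar> / 2"
    have \<delta>: "\<delta> > 0" using nz by (simp add: \<delta>_def)
    have "open {z. \<delta> < \<bar>g (fst z) \<bullet> snd z\<bar>}"
      unfolding g_inner
      by (intro open_Collect_less continuous_intros continuous_on_vec_lambda)
    moreover have "(x, l) \<in> {z. \<delta> < \<bar>g (fst z) \<bullet> snd z\<bar>}"
      using nz by (simp add: \<delta>_def)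
    ultimately obtain A B where AB: "open A" "open B" "x \<in> A" "l \<in> B"
      "A \<times> B \<subseteq> {z. \<delta> < \<bar>g (fst z) \<bullet> snd z\<bar>}"
      by (rule open_prod_elim) auto
    obtain e where e: "e > 0" "ball x e \<subseteq> A"
      using AB(1,3) open_contains_ball by blast
    have "\<forall>\<^sub>F k in sequentially. t (s k) \<in> B"
      using topological_tendstoD[OF lim AB(2,4)] by simp
    \<comment> \<open>A counting form of Markov's inequality: each sensor in the ball adds at least
      the square of \<open>\<delta>\<close> to a sum that is at most
      \<open>N (s k) / Suc (s k)\<close>.\<close>
    then have upper: "\<forall>\<^sub>F k in sequentially. measure (empirical_distr (N (s k)) p) (ball x e)
                 \<le> (1 / \<delta>\<^sup>2) / real (Suc (s k))"
    proof eventually_elim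
      case (elim k)
      let ?I = "{i\<in>{1..N (s k)}. p i \<in> ball x e}"
      have "real (card ?I) * \<delta>\<^sup>2 = (\<Sum>i\<in>?I. \<delta>\<^sup>2)"
        by simp
      also have "\<dots> \<le> (\<Sum>i\<in>?I. (g (p i) \<bullet> t (s k))\<^sup>2)"
      proof (rule sum_mono)
        fix i assume "i \<in> ?I"
        then have "(p i, t (s k)) \<in> A \<times> B" using e(2) elim by auto
        then have "\<delta> < \<bar>g (p i) \<bullet> t (s k)\<bar>" using AB(5) by auto
        then show "\<delta>\<^sup>2 \<le> (g (p i) \<bullet> t (s k))\<^sup>2"
          using \<delta> by (simp add: abs_le_square_iff[symmetric])
      qed
      also have "\<dots> \<le> (\<Sum>i=1..N (s k). (g (p i) \<bullet> t (s k))\<^sup>2)"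
        by (rule sum_mono2) auto
      also have "\<dots> \<le> real (N (s k)) / real (Suc (s k))"
        by (rule small)
      finally have "real (card ?I) * \<delta>\<^sup>2 \<le> real (N (s k)) / real (Suc (s k))" .
      then have "(real (card ?I) * \<delta>\<^sup>2) / (real (N (s k)) * \<delta>\<^sup>2)
          \<le> (real (N (s k)) / real (Suc (s k))) / (real (N (s k)) * \<delta>\<^sup>2)"
        by (rule divide_right_mono) simp
      then have "real (card ?I) / real (N (s k)) \<le> (1 / \<delta>\<^sup>2) / real (Suc (s k))"
        using \<delta> N[of "s k"] by (simp add: mult.commute)
      then show ?case
        using N[of "s k"] by (subst measure_empirical_distr) auto
    qed
    have lim0: "(\<lambda>k. (1 / \<delta>\<^sup>2) / real (Suc (s k))) \<longlonglongrightarrow> 0"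
      using filterlim_compose[OF LIMSEQ_Suc[OF lim_const_over_n[of "1 / \<delta>\<^sup>2"]]
          filterlim_subseq[OF s]] .
    have "(\<lambda>k. measure (empirical_distr (N (s k)) p) (ball x e)) \<longlonglongrightarrow> 0"
      by (rule tendsto_sandwich[OF _ upper tendsto_const lim0]) simp
    then show ?thesis using e(1) by blast
  qed
  then obtain Z where Z: "Z \<in> null_sets \<mu>" "- (H \<inter> closure P) \<subseteq> Z"
    using dist_fun_conv_null_open[OF conv finite_measure_empirical_distr
        prob_space.finite_measure[OF \<mu>(1)] _ \<mu>(2) Ns, of "- (H \<inter> closure P)"]
    by (auto simp: empirical_distr_def)
  interpret \<mu>: prob_space \<mu> by (fact \<mu>(1))
  have borel: "H \<inter> closure P \<in> sets borel"
    using H_closed by auto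
  have "AE x in \<mu>. x \<in> H \<inter> closure P"
    by (rule AE_I'[OF Z(1)]) (use Z(2) in auto)
  then have full: "measure \<mu> (H \<inter> closure P) = 1"
    using borel \<mu>(2) by (intro \<mu>.prob_eq_1[THEN iffD2]) auto
  let ?u = "\<chi> k. l $ Some k"
  have H_eq: "H = {x. (2 *\<^sub>R ?u) \<bullet> x = l $ None}"
    using b by (auto simp: H_def g_inner)
  show False
  proof (cases "?u = 0")
    \<comment> \<open>Then \<open>l\<close> is concentrated in its constant entry, so the affine
      function is a nonzero constant and \<open>H\<close> is empty, although it carries mass
      one.\<close>
    case True
    then have "l $ Some k = 0" for k
      by (metis vec_lambda_beta zero_index)
    moreover have "l \<noteq> 0" using l by auto
    ultimately have "l $ None \<noteq> 0"
      by (metis (full_types) option.exhaust vec_eq_iff zero_index)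
    then have "H = {}" unfolding H_eq True by auto
    then show False using full by simp
  next
    case False
    have "on_hyperplane (H \<inter> closure P)"
      unfolding on_hyperplane_def
    proof (intro exI conjI)
      show "affine H" unfolding H_eq by (rule affine_hyperplane)
      show "aff_dim H = int CARD('m) - 1"
        unfolding H_eq using False by (subst aff_dim_hyperplane) auto
    qed auto
    with full borel have "full_mass_on_hyperplane \<mu> P"
      unfolding full_mass_on_hyperplane_def
      by (intro exI[of _ "H \<inter> closure P"] conjI Int_lower2)
    with nondeg show False ..
  qed
qed

section \<open>Error of the least-squares solution\<close>

lemma gram_matrix_mult_vec:
  "gram_matrix n X *v \<theta> = (\<Sum>i=1..n. (X i \<bullet> \<theta>) *\<^sub>R X i)"
proof (rule vec_eq_iff[THEN iffD2], rule allI)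
  fix j
  have "(gram_matrix n X *v \<theta>) $ j = (\<Sum>k\<in>UNIV. \<Sum>i=1..n. X i $ j * X i $ k * \<theta> $ k)"
    by (simp add: gram_matrix_def matrix_vector_mult_def sum_distrib_right)
  also have "\<dots> = (\<Sum>i=1..n. \<Sum>k\<in>UNIV. X i $ j * X i $ k * \<theta> $ k)"
    by (rule sum.swap)
  also have "\<dots> = (\<Sum>i=1..n. (X i \<bullet> \<theta>) *\<^sub>R X i) $ j"
    by (simp add: inner_vec_def sum_distrib_left sum_distrib_right mult_ac)
  finally show "(gram_matrix n X *v \<theta>) $ j = (\<Sum>i=1..n. (X i \<bullet> \<theta>) *\<^sub>R X i) $ j" .
qed

lemma transpose_mult_vec_eq:
  "transpose_mult_vec n X Y = (\<Sum>i=1..n. Y i *\<^sub>R X i)"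
  by (simp add: transpose_mult_vec_def vec_eq_iff mult_ac)

text \<open>The lower bound makes the Gram matrix invertible, so the normal equations hold and the
  Gram matrix maps the estimation error to \<open>\<Sum>i=1..n. e i *\<^sub>R X i\<close>. Pairing
  this with the error itself and applying Cauchy-Schwarz gives the estimate.\<close>

lemma norm_least_squares_error_le:
  fixes X :: "nat \<Rightarrow> real^'k"
  assumes c: "c > 0"
    and lower: "\<And>\<theta>. c * (norm \<theta>)\<^sup>2 \<le> (\<Sum>i=1..n. (X i \<bullet> \<theta>)\<^sup>2)"
    and Y: "\<And>i. i \<in> {1..n} \<Longrightarrow> Y i = X i \<bullet> \<theta>0 + e i"
  shows "norm (least_squares n X Y - \<theta>0) \<le> norm (\<Sum>i=1..n. e i *\<^sub>R X i) / c"
proof -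
  let ?G = "gram_matrix n X" and ?w = "least_squares n X Y - \<theta>0"
    and ?v = "\<Sum>i=1..n. e i *\<^sub>R X i"
  have quad: "c * (norm \<theta>)\<^sup>2 \<le> \<theta> \<bullet> (?G *v \<theta>)" for \<theta>
    using lower[of \<theta>]
    by (simp add: gram_matrix_mult_vec inner_sum_right power2_eq_square inner_commute)
  have "\<theta> = 0" if "?G *v \<theta> = 0" for \<theta>
    using quad[of \<theta>] c that by (simp add: mult_le_0_iff)
  then have "invertible ?G"
    by (simp add: invertible_left_inverse matrix_left_invertible_ker)
  \<comment> \<open>\<open>matrix_inv\<close> is a choice among two-sided inverses, so its property
    follows once an inverse exists.\<close>
  then have "?G ** matrix_inv ?G = mat 1"
    unfolding invertible_def matrix_inv_def by (rule someI2_ex) blast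
  then have "?G *v least_squares n X Y = transpose_mult_vec n X Y"
    by (simp add: least_squares_def matrix_vector_mul_assoc)
  also have "\<dots> = ?G *v \<theta>0 + ?v"
    using Y by (simp add: transpose_mult_vec_eq gram_matrix_mult_vec sum.distrib[symmetric] algebra_simps)
  finally have "?G *v ?w = ?v"
    by (simp add: matrix_vector_mult_diff_distrib)
  then have "c * (norm ?w)\<^sup>2 \<le> ?w \<bullet> ?v"
    using quad[of ?w] by simp
  also have "\<dots> \<le> norm ?w * norm ?v"
    by (rule norm_cauchy_schwarz)
  finally have "norm ?w * (c * norm ?w) \<le> norm ?w * norm ?v"
    by (simp add: power2_eq_square mult_ac)
  then have "c * norm ?w \<le> norm ?v"
    by (cases "?w = 0") auto
  then show ?thesis
    using c by (simp add: field_simps)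
qed

subsection \<open>Moments of the noise\<close>

text \<open>Chebyshev's inequality for vectors: in the expected squared norm the off-diagonal terms
  vanish by independence and centring, and each diagonal term is at most
  \<open>V * B\<^sup>2\<close>.\<close>

lemma (in prob_space) prob_norm_weighted_sum_ge_le:
  fixes \<eta> :: "'i \<Rightarrow> 'a \<Rightarrow> real" and a :: "'i \<Rightarrow> 'b::euclidean_space"
  assumes indep: "indep_vars (\<lambda>_. borel) \<eta> I" and I: "finite I"
    and sq: "\<And>i. i \<in> I \<Longrightarrow> integrable M (\<lambda>x. (\<eta> i x)\<^sup>2)"
    and mean: "\<And>i. i \<in> I \<Longrightarrow> expectation (\<eta> i) = 0"
    and var: "\<And>i. i \<in> I \<Longrightarrow> expectation (\<lambda>x. (\<eta> i x)\<^sup>2) \<le> V"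
    and a: "\<And>i. i \<in> I \<Longrightarrow> norm (a i) \<le> B" and t: "t > 0"
  shows "prob {x\<in>space M. norm (\<Sum>i\<in>I. \<eta> i x *\<^sub>R a i) \<ge> t} \<le> real (card I) * (V * B\<^sup>2) / t\<^sup>2"
proof -
  have meas: "\<eta> i \<in> borel_measurable M" if "i \<in> I" for i
    using indep that by (simp add: indep_vars_def)
  have int: "integrable M (\<eta> i)" if "i \<in> I" for i
    using square_integrable_imp_integrable[OF meas sq] that by blast
  have cross: "integrable M (\<lambda>x. \<eta> i x * \<eta> j x)"
      "expectation (\<lambda>x. \<eta> i x * \<eta> j x) = (if i = j then expectation (\<lambda>x. (\<eta> i x)\<^sup>2) else 0)"
    if ij: "i \<in> I" "j \<in> I" for i j
  proof -
    have "integrable M (\<lambda>x. \<eta> i x * \<eta> j x) \<and> expectation (\<lambda>x. \<eta> i x * \<eta> j x) = 0" if "i \<noteq> j"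
    proof -
      have ind: "indep_vars (\<lambda>_. borel) \<eta> {i, j}"
        using indep ij by (auto intro: indep_vars_subset)
      have "integrable M (\<lambda>x. \<Prod>k\<in>{i, j}. \<eta> k x)"
        by (rule indep_vars_integrable[OF _ ind]) (use int ij in auto)
      moreover have "expectation (\<lambda>x. \<Prod>k\<in>{i, j}. \<eta> k x) = (\<Prod>k\<in>{i, j}. expectation (\<eta> k))"
        by (rule indep_vars_lebesgue_integral[OF _ ind]) (use int ij in auto)
      ultimately show ?thesis
        using that mean[OF ij(1)] by simp
    qed
    then show "integrable M (\<lambda>x. \<eta> i x * \<eta> j x)"
      "expectation (\<lambda>x. \<eta> i x * \<eta> j x) = (if i = j then expectation (\<lambda>x. (\<eta> i x)\<^sup>2) else 0)"
      using sq[OF ij(1)] by (cases "i = j"; simp add: power2_eq_square)+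
  qed
  let ?S = "\<lambda>x. \<Sum>i\<in>I. \<eta> i x *\<^sub>R a i"
  have expand: "(norm (?S x))\<^sup>2 = (\<Sum>i\<in>I. \<Sum>j\<in>I. (a i \<bullet> a j) * (\<eta> i x * \<eta> j x))" for x
    unfolding power2_norm_eq_inner inner_sum_left inner_sum_right inner_scaleR_left inner_scaleR_right
    by (subst sum.swap) (simp add: sum_distrib_left mult_ac inner_commute)
  have S_int: "integrable M (\<lambda>x. (norm (?S x))\<^sup>2)"
    unfolding expand using cross(1) by (intro Bochner_Integration.integrable_sum integrable_mult_right) auto
  have "expectation (\<lambda>x. (norm (?S x))\<^sup>2)
      = (\<Sum>i\<in>I. \<Sum>j\<in>I. (a i \<bullet> a j) * expectation (\<lambda>x. \<eta> i x * \<eta> j x))"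
    unfolding expand using cross(1) by (simp add: Bochner_Integration.integral_sum)
  also have "\<dots> = (\<Sum>i\<in>I. expectation (\<lambda>x. (\<eta> i x)\<^sup>2) * (norm (a i))\<^sup>2)"
    using I by (intro sum.cong refl)
      (simp add: cross(2) if_distrib[of "\<lambda>z. _ * z"] power2_norm_eq_inner mult_ac cong: if_cong)
  also have "\<dots> \<le> (\<Sum>i\<in>I. V * B\<^sup>2)"
  proof (rule sum_mono)
    fix i assume i: "i \<in> I"
    have "0 \<le> expectation (\<lambda>x. (\<eta> i x)\<^sup>2)" by simp
    then have "0 \<le> V" using var[OF i] by linarith
    then show "expectation (\<lambda>x. (\<eta> i x)\<^sup>2) * (norm (a i))\<^sup>2 \<le> V * B\<^sup>2"
      using var[OF i] a[OF i] by (intro mult_mono power_mono) auto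
  qed
  finally have E: "expectation (\<lambda>x. (norm (?S x))\<^sup>2) \<le> real (card I) * (V * B\<^sup>2)"
    by simp
  have "{x\<in>space M. norm (?S x) \<ge> t} = {x\<in>space M. (norm (?S x))\<^sup>2 \<ge> t\<^sup>2}"
    using t by (simp add: abs_le_square_iff[symmetric])
  then have "prob {x\<in>space M. norm (?S x) \<ge> t} \<le> expectation (\<lambda>x. (norm (?S x))\<^sup>2) / t\<^sup>2"
    using integral_Markov_inequality_measure[OF S_int, of "{}" "t\<^sup>2"] t by simp
  also have "\<dots> \<le> real (card I) * (V * B\<^sup>2) / t\<^sup>2"
    using E by (simp add: divide_right_mono)
  finally show ?thesis .
qed

text \<open>The constant \<open>b\<close> is the mean of \<open>10 powr (2 * W x)\<close>, so
  subtracting it centres the noise; the variance is then bounded by the raw second moment.\<close>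

lemma (in prob_space) lognormal_noise_moments:
  fixes \<sigma> \<alpha> :: real
  assumes pos: "\<sigma> > 0" "\<alpha> > 0"
    and D: "distributed M lborel W (normal_density 0 (\<sigma> / (10 * \<alpha>)))"
  defines "b \<equiv> exp ((ln 10)\<^sup>2 * \<sigma>\<^sup>2 / (50 * \<alpha>\<^sup>2))"
  shows "expectation (\<lambda>x. 10 powr (2 * W x) - b) = 0"
    and "integrable M (\<lambda>x. (10 powr (2 * W x) - b)\<^sup>2)"
    and "expectation (\<lambda>x. (10 powr (2 * W x) - b)\<^sup>2) \<le> exp ((ln 10)\<^sup>2 * (2 * \<sigma>)\<^sup>2 / (50 * \<alpha>\<^sup>2))"
proof -
  let ?Z = "\<lambda>x. 10 powr (2 * W x)"
  have E1: "expectation ?Z = b"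
    unfolding b_def by (rule expectation_10_powr_normal[OF pos D])
  \<comment> \<open>The integral of a nonintegrable function is \<open>0\<close> by convention, so a
    nonzero value implies integrability.\<close>
  then have I1: "integrable M ?Z"
    using not_integrable_integral_eq by (fastforce simp: b_def)
  \<comment> \<open>The second moment of \<open>10 powr (2 * W)\<close> is the first moment for the noise \<open>2 * W\<close>.\<close>
  have D2: "distributed M lborel (\<lambda>x. 2 * W x) (normal_density 0 (2 * \<sigma> / (10 * \<alpha>)))"
    using normal_density_affine[OF D, of 2 0] pos by simp
  have sq: "(?Z x)\<^sup>2 = 10 powr (2 * (2 * W x))" for x
    by (simp add: power2_eq_square powr_add[symmetric])
  have E2: "expectation (\<lambda>x. (?Z x)\<^sup>2) = exp ((ln 10)\<^sup>2 * (2 * \<sigma>)\<^sup>2 / (50 * \<alpha>\<^sup>2))"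
    unfolding sq by (rule expectation_10_powr_normal[OF _ _ D2]) (use pos in auto)
  then have I2: "integrable M (\<lambda>x. (?Z x)\<^sup>2)"
    using not_integrable_integral_eq[of M "\<lambda>x. (?Z x)\<^sup>2"] by (metis exp_not_eq_zero)
  show "expectation (\<lambda>x. ?Z x - b) = 0"
    using E1 I1 by (simp add: prob_space)
  have expand: "(?Z x - b)\<^sup>2 = (?Z x)\<^sup>2 - 2 * b * ?Z x + b\<^sup>2" for x
    by (simp add: power2_eq_square algebra_simps)
  show "integrable M (\<lambda>x. (?Z x - b)\<^sup>2)"
    unfolding expand using I1 I2 by simp
  have "expectation (\<lambda>x. (?Z x - b)\<^sup>2) = expectation (\<lambda>x. (?Z x)\<^sup>2) - b\<^sup>2"
    unfolding expand using I1 I2 E1 by (simp add: prob_space power2_eq_square)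
  then show "expectation (\<lambda>x. (?Z x - b)\<^sup>2) \<le> exp ((ln 10)\<^sup>2 * (2 * \<sigma>)\<^sup>2 / (50 * \<alpha>\<^sup>2))"
    using E2 by simp
qed

subsection \<open>Rate of convergence of the estimator\<close>

lemma norm_vec_lambda_Some_le:
  fixes v :: "real^('m::finite) option"
  shows "norm (\<chi> k. v $ Some k) \<le> norm v"
proof (rule power2_le_imp_le)
  show "(norm (\<chi> k. v $ Some k))\<^sup>2 \<le> (norm v)\<^sup>2"
    unfolding power2_norm_eq_inner inner_vec_def by (simp add: sum_UNIV_option)
qed simp

text \<open>The estimator is a linear combination of the responses with deterministic coefficients.
  This yields its measurability for every \<open>n\<close>, also when the Gram matrix is
  singular.\<close>

lemma p_hat_eq_sum:
  "p_hat b p y n = (\<Sum>i=1..n. response b p y i *\<^sub>R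
     (\<chi> k. (matrix_inv (gram_matrix n (design_row b p)) *v design_row b p i) $ Some k))"
  by (simp add: p_hat_def theta_hat_def least_squares_def transpose_mult_vec_eq vec_eq_iff
      vec.linear_sum matrix_vector_mult_scaleR vec.sum)

lemma borel_measurable_p_hat:
  assumes "\<And>i. i \<ge> 1 \<Longrightarrow> y i \<in> borel_measurable M"
  shows "(\<lambda>x. p_hat b p (\<lambda>i. y i x) n) \<in> borel_measurable M"
  unfolding p_hat_eq_sum response_def
proof (intro borel_measurable_sum borel_measurable_scaleR borel_measurable_const)
  fix i assume "i \<in> {1..n}"
  then have [measurable]: "y i \<in> borel_measurable M" using assms by simp
  show "(\<lambda>x. 10 powr (2 * y i x) - b * (norm (p i))\<^sup>2) \<in> borel_measurable M"
    by measurable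
qed

theorem theorem2:
  fixes M :: "'a measure"
    and p0 :: "real^'m" and p :: "nat \<Rightarrow> real^'m"
    and \<alpha> \<sigma> b :: real
    and \<omega> y :: "nat \<Rightarrow> 'a \<Rightarrow> real"
    and P0 P :: "(real^'m) set"
    and \<mu> :: "(real^'m) measure" and F\<mu> :: "real^'m \<Rightarrow> real"
  assumes dim: "CARD('m) \<in> {2, 3}"
    and alpha: "\<alpha> > 0" and sigma: "\<sigma> > 0"
    and prob: "prob_space M"
    and noise_indep: "prob_space.indep_vars M (\<lambda>_. borel) \<omega> {1..}"
    and noise_normal: "\<And>i. i \<ge> 1 \<Longrightarrow> distributed M lborel (\<omega> i) (normal_density 0 (\<sigma> / (10 * \<alpha>)))"
    and obs: "\<And>i x. i \<ge> 1 \<Longrightarrow> x \<in> space M \<Longrightarrow> y i x = log 10 (norm (p i - p0)) + \<omega> i x"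
    and source: "bounded P0" "p0 \<in> P0"
    and sensors: "bounded P" "\<And>i. i \<ge> 1 \<Longrightarrow> p i \<in> P"
    and disjoint: "P0 \<inter> P = {}"
    and limit_measure: "prob_space \<mu>" "sets \<mu> = sets borel" "F\<mu> = dist_fun \<mu>"
    and limit: "dist_fun_conv (\<lambda>n. dist_fun (empirical_distr n p)) F\<mu>"
    and sensors_nondegenerate: "\<And>n. n \<ge> CARD('m) + 1 \<Longrightarrow> \<not> on_hyperplane (p ` {1..n})"
    and limit_nondegenerate: "\<not> full_mass_on_hyperplane \<mu> P"
    and b: "b = exp ((ln 10)\<^sup>2 * \<sigma>\<^sup>2 / (50 * \<alpha>\<^sup>2))"
  shows "bigO_prob M (\<lambda>n x. p_hat b p (\<lambda>i. y i x) n - p0) (\<lambda>n. 1 / sqrt (real n))"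
proof -
  interpret prob_space M by (fact prob)
  \<comment> \<open>Treating the squared norm of \<open>p0\<close> as a separate unknown makes the
    squared distance to a sensor linear in the parameter.\<close>
  define \<theta>0 where "\<theta>0 = (\<chi> j. case j of Some k \<Rightarrow> p0 $ k | None \<Rightarrow> (norm p0)\<^sup>2)"
  define \<eta> where "\<eta> i x = 10 powr (2 * \<omega> i x) - b" for i x
  define a where "a i = (norm (p i - p0))\<^sup>2 *\<^sub>R design_row b p i" for i
  define V where "V = exp ((ln 10)\<^sup>2 * (2 * \<sigma>)\<^sup>2 / (50 * \<alpha>\<^sup>2))"
  define S where "S n x = (\<Sum>i=1..n. \<eta> i x *\<^sub>R a i)" for n x
  have b_pos: "b > 0" by (simp add: b)

  have resp: "response b p (\<lambda>i. y i x) i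
      = design_row b p i \<bullet> \<theta>0 + (norm (p i - p0))\<^sup>2 * \<eta> i x"
    if "i \<ge> 1" "x \<in> space M" for i x
  proof -
    \<comment> \<open>A positive distance is needed to undo the logarithm, since a power of
      \<open>10\<close> is never zero.\<close>
    have "p i \<noteq> p0" using sensors(2)[OF that(1)] source(2) disjoint by auto
    then have d: "norm (p i - p0) > 0" by simp
    have "10 powr (2 * y i x) = (10 powr log 10 (norm (p i - p0)))\<^sup>2 * 10 powr (2 * \<omega> i x)"
      using that by (simp add: obs power2_eq_square powr_add[symmetric] algebra_simps)
    then have "10 powr (2 * y i x) = (norm (p i - p0))\<^sup>2 * 10 powr (2 * \<omega> i x)"
      using d by simp
    moreover have "design_row b p i \<bullet> \<theta>0 = b * (norm (p i - p0))\<^sup>2 - b * (norm (p i))\<^sup>2"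
      by (simp add: inner_design_row \<theta>0_def power2_norm_eq_inner inner_diff_left inner_diff_right
          inner_commute algebra_simps)
    ultimately show ?thesis
      by (simp add: response_def \<eta>_def algebra_simps)
  qed

  obtain R where R: "\<And>i. i \<ge> 1 \<Longrightarrow> norm (p i) \<le> R"
    using sensors unfolding bounded_iff by blast
  \<comment> \<open>Product of uniform bounds for the squared distance and for the norm of the
    design row, both from the boundedness of the sensor set.\<close>
  define B where "B = (R + norm p0)\<^sup>2 * (\<bar>b\<bar> * (1 + 2 * R))"
  have a_le: "norm (a i) \<le> B" if i: "i \<ge> 1" for i
  proof -
    have "norm (p i - p0) \<le> R + norm p0"
      using norm_triangle_ineq4[of "p i" p0] R[OF i] by linarith
    then have "(norm (p i - p0))\<^sup>2 \<le> (R + norm p0)\<^sup>2"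
      by (intro power_mono) auto
    moreover have "norm (design_row b p i) \<le> \<bar>b\<bar> * (1 + 2 * R)"
      by (rule order_trans[OF norm_design_row_le mult_left_mono]) (use R[OF i] in auto)
    ultimately show ?thesis
      unfolding a_def B_def norm_scaleR by (intro mult_mono) auto
  qed

  have tail: "prob {x\<in>space M. norm (S n x) \<ge> t} \<le> real n * (V * B\<^sup>2) / t\<^sup>2" if "t > 0" for n t
  proof -
    have "indep_vars (\<lambda>_. borel) \<eta> {1..n}"
      unfolding \<eta>_def
      by (rule indep_vars_compose2[OF indep_vars_subset[OF noise_indep]]) auto
    then have "prob {x\<in>space M. norm (\<Sum>i\<in>{1..n}. \<eta> i x *\<^sub>R a i) \<ge> t}
        \<le> real (card {1..n}) * (V * B\<^sup>2) / t\<^sup>2"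
    proof (rule prob_norm_weighted_sum_ge_le)
      fix i assume "i \<in> {1..n}"
      then have i: "i \<ge> 1" by simp
      note mom = lognormal_noise_moments[OF sigma alpha noise_normal[OF i], folded b]
      show "integrable M (\<lambda>x. (\<eta> i x)\<^sup>2)" "expectation (\<eta> i) = 0"
        "expectation (\<lambda>x. (\<eta> i x)\<^sup>2) \<le> V" "norm (a i) \<le> B"
        using mom a_le[OF i] by (simp_all add: \<eta>_def[abs_def] V_def)
    qed (use that in auto)
    then show ?thesis by (simp add: S_def)
  qed

  obtain c where c: "c > 0" and gram: "\<forall>\<^sub>F n in sequentially.
      \<forall>\<theta>. c * real n * (norm \<theta>)\<^sup>2 \<le> (\<Sum>i=1..n. (design_row b p i \<bullet> \<theta>)\<^sup>2)"
    using gram_lower_bound[OF sensors(2) limit_measure(1,2) limit[unfolded limit_measure(3)]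
        limit_nondegenerate less_imp_neq[OF b_pos, symmetric]]
    by blast

  \<comment> \<open>The Gram bound contributes \<open>1 / (c * real n)\<close>; rescaling by
    \<open>sqrt (real n)\<close> leaves \<open>1 / (c * sqrt (real n))\<close>, which matches the
    order of \<open>S n\<close>.\<close>
  have scaled: "norm ((p_hat b p (\<lambda>i. y i x) n - p0) /\<^sub>R (1 / sqrt (real n)))
      \<le> norm (S n x) / (c * sqrt (real n))"
    if n: "n \<ge> 1" and x: "x \<in> space M"
      and lower: "\<forall>\<theta>. c * real n * (norm \<theta>)\<^sup>2 \<le> (\<Sum>i=1..n. (design_row b p i \<bullet> \<theta>)\<^sup>2)" for n x
  proof -
    have "p_hat b p (\<lambda>i. y i x) n - p0 = (\<chi> k. (theta_hat b p (\<lambda>i. y i x) n - \<theta>0) $ Some k)"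
      by (simp add: p_hat_def \<theta>0_def vec_eq_iff)
    then have "norm (p_hat b p (\<lambda>i. y i x) n - p0) \<le> norm (theta_hat b p (\<lambda>i. y i x) n - \<theta>0)"
      using norm_vec_lambda_Some_le by metis
    also have "\<dots> \<le> norm (\<Sum>i=1..n. ((norm (p i - p0))\<^sup>2 * \<eta> i x) *\<^sub>R design_row b p i) / (c * real n)"
      unfolding theta_hat_def
      by (rule norm_least_squares_error_le) (use c n lower resp x in auto)
    also have "\<dots> = norm (S n x) / (c * real n)"
      by (simp add: S_def a_def mult.commute)
    finally have "sqrt (real n) * norm (p_hat b p (\<lambda>i. y i x) n - p0)
        \<le> sqrt (real n) * (norm (S n x) / (c * real n))"
      by (rule mult_left_mono) simp
    also have "\<dots> = norm (S n x) / (c * sqrt (real n))"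
    proof -
      have "real n = sqrt (real n) * sqrt (real n)" by simp
      then show ?thesis using n c by (metis (no_types, lifting) mult.left_commute
            mult_divide_mult_cancel_left of_nat_0_eq_iff not_one_le_zero real_sqrt_eq_zero_cancel_iff
            times_divide_eq_right)
    qed
    finally show ?thesis by (simp add: divide_inverse)
  qed

  show ?thesis
    unfolding bigO_prob_def bounded_in_prob_def
  proof (intro conjI allI impI)
    fix n
    have "y i \<in> borel_measurable M" if "i \<ge> 1" for i
    proof -
      have "\<omega> i \<in> borel_measurable M"
        using noise_indep that by (simp add: indep_vars_def)
      then have "(\<lambda>x. log 10 (norm (p i - p0)) + \<omega> i x) \<in> borel_measurable M"
        by simp
      then show ?thesis
        using obs[OF that] by (simp cong: measurable_cong)
    qed
    then have "(\<lambda>x. p_hat b p (\<lambda>i. y i x) n) \<in> borel_measurable M"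
      by (rule borel_measurable_p_hat)
    then show "(\<lambda>x. (p_hat b p (\<lambda>i. y i x) n - p0) /\<^sub>R (1 / sqrt (real n))) \<in> borel_measurable M"
      by simp
  next
    fix \<epsilon> :: real assume \<epsilon>: "\<epsilon> > 0"
    \<comment> \<open>Chosen so that the tail bound \<open>V * B\<^sup>2 / (K * c)\<^sup>2\<close>
      is at most \<open>\<epsilon>\<close>; the summand \<open>1\<close> ensures
      \<open>K \<ge> 1\<close>, whence \<open>K - 1 \<le> K\<^sup>2\<close>.\<close>
    define K where "K = 1 + V * B\<^sup>2 / (c\<^sup>2 * \<epsilon>)"
    have VB: "V * B\<^sup>2 \<ge> 0" by (simp add: V_def)
    then have K: "K \<ge> 1" using c \<epsilon> by (simp add: K_def)
    have K_bound: "V * B\<^sup>2 / (K * c)\<^sup>2 \<le> \<epsilon>"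
    proof -
      have "V * B\<^sup>2 = (K - 1) * (c\<^sup>2 * \<epsilon>)"
        using c \<epsilon> by (simp add: K_def)
      also have "\<dots> \<le> K\<^sup>2 * (c\<^sup>2 * \<epsilon>)"
      proof (rule mult_right_mono)
        have "K * 1 \<le> K * K" using K by (intro mult_left_mono) auto
        then show "K - 1 \<le> K\<^sup>2" by (simp add: power2_eq_square)
      qed (use \<epsilon> in simp)
      finally show ?thesis
        using K c by (simp add: field_simps power_mult_distrib)
    qed
    have "\<forall>\<^sub>F n in sequentially. prob {x\<in>space M.
        norm ((p_hat b p (\<lambda>i. y i x) n - p0) /\<^sub>R (1 / sqrt (real n))) > K} \<le> \<epsilon>"
      using gram eventually_ge_at_top[of "1::nat"]
    proof eventually_elim
      case (elim n)
      let ?t = "K * c * sqrt (real n)"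
      have t: "?t > 0" using K c elim(2) by simp
      have S_meas: "S n \<in> borel_measurable M"
      proof -
        have "\<omega> i \<in> borel_measurable M" if "i \<in> {1..n}" for i
          using noise_indep that by (simp add: indep_vars_def)
        then show ?thesis
          unfolding S_def[abs_def] \<eta>_def by (intro borel_measurable_sum) auto
      qed
      have "prob {x\<in>space M. norm ((p_hat b p (\<lambda>i. y i x) n - p0) /\<^sub>R (1 / sqrt (real n))) > K}
          \<le> prob {x\<in>space M. norm (S n x) \<ge> ?t}"
      proof (rule finite_measure_mono)
        show "{x\<in>space M. norm ((p_hat b p (\<lambda>i. y i x) n - p0) /\<^sub>R (1 / sqrt (real n))) > K}
            \<subseteq> {x\<in>space M. norm (S n x) \<ge> ?t}"
        proof safe
          fix x assume x: "x \<in> space M"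
            and gt: "norm ((p_hat b p (\<lambda>i. y i x) n - p0) /\<^sub>R (1 / sqrt (real n))) > K"
          have "K < norm (S n x) / (c * sqrt (real n))"
            using gt scaled[OF elim(2) x elim(1)] by linarith
          then show "?t \<le> norm (S n x)"
            using c elim(2) by (simp add: pos_less_divide_eq mult.assoc)
        qed
        show "{x\<in>space M. norm (S n x) \<ge> ?t} \<in> events"
          using S_meas by measurable
      qed
      also have "\<dots> \<le> real n * (V * B\<^sup>2) / ?t\<^sup>2"
        using t by (rule tail)
      \<comment> \<open>The threshold grows like \<open>sqrt (real n)\<close>, so the number of
        summands cancels and the bound is uniform in \<open>n\<close>.\<close>
      also have "\<dots> = V * B\<^sup>2 / (K * c)\<^sup>2"
        using elim(2) by (simp add: power_mult_distrib)
      also have "\<dots> \<le> \<epsilon>" by (rule K_bound)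
      finally show ?case .
    qed
    then show "\<exists>K. \<forall>\<^sub>F n in sequentially. prob {x\<in>space M.
        norm ((p_hat b p (\<lambda>i. y i x) n - p0) /\<^sub>R (1 / sqrt (real n))) > K} \<le> \<epsilon>"
      by blast
  qed
qed

end
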